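(* Let $n\ge 1$ be an integer. For $t\in[0,1]$ put $T:=t(1-t)$. Then for all $t\in[0,1]$, $$\bigl(1+(n-3)T\bigr)^{-\frac{2n}{n-3}}\le S_{n,-1}(t)\le\left(1+\frac{4n^2-2n-4}{n+1}T\right)^{-\frac{n(n+1)}{2n^2-n-2}},$$ where for $n=3$ the left-hand side is to be read as $e^{-6T}$.
   Context: For integers $n\ge1$ and $x\in[0,1]$, $S_{n,-1}$ denotes the index of coincidence of the binomial distribution with parameters $n$ and $x$: $$S_{n,-1}(x):=\sum_{k=0}^n\left(\binom{n}{k}x^k(1-x)^{n-k}\right)^2$$ (with $0^0=1$). *)

theory Defs
  imports Complex_Main
begin

definition index_of_coincidence_binomial :: "nat \<Rightarrow> real \<Rightarrow> real" where
  "index_of_coincidence_binomial n x =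
     (\<Sum>k=0..n. (real (n choose k) * x ^ k * (1 - x) ^ (n - k))\<^sup>2)"

end

theory Submission
  imports Defs "HOL-Computational_Algebra.Polynomial"
begin

text \<open>As a function \<open>F\<close> of \<open>T = t (1 - t) \<in> [0, 1/4]\<close>, the index of coincidence is a hypergeometric
  polynomial with \<open>T (1 - 4T) F'' + (1 + (4n - 6) T) F' + 2n F = 0\<close>. Both bounds have the form
  \<open>D powr (- 2n/c)\<close> with \<open>D = 1 + c T\<close> (\<open>exp (- 2n T)\<close> if \<open>c = 0\<close>), and comparing \<open>F\<close> with such a power amounts to determining
  the sign of \<open>G = 2n F + D F'\<close>. The differential equation for \<open>F\<close> yields
  \<open>T (1 - 4T) D G' + p G = 2n R F\<close> with explicit quadratic polynomials \<open>p > 0\<close> and \<open>R\<close>. At an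
  extremum of \<open>G\<close> the first term vanishes: in the interior because \<open>G' = 0\<close>, and at \<open>0\<close> and \<open>1/4\<close>
  because the coefficient does. So \<open>G\<close> inherits the sign of \<open>R\<close>, which is nonnegative for
  \<open>c = n - 3\<close> and nonpositive for \<open>c = (4n\<^sup>2 - 2n - 4) / (n + 1)\<close>.\<close>

section \<open>The hypergeometric polynomial and its differential equation\<close>

text \<open>This is the Gauss series 2F1(-n, 1/2; 1; 4T), which terminates at degree
  \<open>n\<close>.\<close>

definition coincidence_poly :: "nat \<Rightarrow> real poly" where
  "coincidence_poly n = (\<Sum>j\<le>n. monom ((-1) ^ j * of_nat (n choose j) * of_nat (2 * j choose j)) j)"

lemma coeff_coincidence_poly:
  "coeff (coincidence_poly n) j = (-1) ^ j * of_nat (n choose j) * of_nat (2 * j choose j)"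
  by (simp add: coincidence_poly_def coeff_sum binomial_eq_0)

text \<open>Both sides are the coefficient of \<open>s\<^sup>n\<close> in
  \<open>((1 - t) + t s)\<^sup>n (t + (1 - t) s)\<^sup>n = (s + t (1 - t) (1 - s)\<^sup>2)\<^sup>n\<close>.\<close>

lemma index_of_coincidence_binomial_eq_poly:
  "index_of_coincidence_binomial n t = poly (coincidence_poly n) (t * (1 - t))"
proof -
  have 1: "coeff ([:1 - t, t:] ^ n * [:t, 1 - t:] ^ n) n = index_of_coincidence_binomial n t"
    unfolding coeff_mult index_of_coincidence_binomial_def atLeast0AtMost
    by (rule sum.cong)
      (auto simp: coeff_linear_poly_power power2_eq_square binomial_symmetric[symmetric])
  have "[:1 - t, t:] * [:t, 1 - t:] = smult (t * (1 - t)) ([:1, -1:] ^ 2) + monom 1 1"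
    by (simp add: power2_eq_square monom_altdef algebra_simps)
  then have "[:1 - t, t:] ^ n * [:t, 1 - t:] ^ n =
      (smult (t * (1 - t)) ([:1, -1:] ^ 2) + monom 1 1) ^ n"
    by (metis power_mult_distrib)
  also have "\<dots> = (\<Sum>j\<le>n. of_nat (n choose j) *
      (monom 1 (n - j) * smult ((t * (1 - t)) ^ j) ([:1, -1:] ^ (2 * j))))"
    unfolding binomial_ring
    by (rule sum.cong) (simp_all add: smult_power monom_power algebra_simps flip: power_mult)
  finally have "coeff ([:1 - t, t:] ^ n * [:t, 1 - t:] ^ n) n =
      (\<Sum>j\<le>n. of_nat (n choose j) * ((t * (1 - t)) ^ j * (of_nat (2 * j choose j) * (-1) ^ j)))"
    by (auto simp: coeff_sum coeff_monom_mult coeff_linear_poly_power of_nat_poly intro!: sum.cong)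
  also have "\<dots> = poly (coincidence_poly n) (t * (1 - t))"
    by (simp add: coincidence_poly_def poly_sum poly_monom mult_ac)
  finally show ?thesis using 1 by simp
qed

text \<open>Comparing coefficients turns the equation into the two-term recurrence
  \<open>rec\<close>, which combines the ratios of consecutive values of \<open>n choose j\<close>
  and of the central binomial coefficients.\<close>

lemma coincidence_poly_ode:
  "[:0, 1, -4:] * pderiv (pderiv (coincidence_poly n))
    + [:1, 4 * of_nat n - 6:] * pderiv (coincidence_poly n)
    + smult (2 * of_nat n) (coincidence_poly n) = 0"
proof (rule poly_eqI)
  fix j
  let ?c = "coeff (coincidence_poly n)"
  have rec: "(real j + 1)\<^sup>2 * ?c (Suc j) = - (real n - real j) * (4 * real j + 2) * ?c j"
  proof -
    have "Suc j * (n choose Suc j) = (n - j) * (n choose j)"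
      by (simp only: binomial_absorption binomial_absorb_comp)
    then have "real (Suc j * (n choose Suc j)) = real ((n - j) * (n choose j))"
      by (rule arg_cong)
    then have 1: "(real j + 1) * (n choose Suc j) = (real n - real j) * (n choose j)"
      by (cases "j \<le> n") (simp_all add: of_nat_diff binomial_eq_0 algebra_simps)
    have "Suc (2 * j) choose j = Suc (2 * j) choose Suc j"
      using binomial_symmetric[of j "Suc (2 * j)"] by simp
    then have "Suc j * (Suc (Suc (2 * j)) choose Suc j)
        = 2 * (Suc j * (Suc (2 * j) choose Suc j))"
      using Suc_times_binomial[of j "Suc (2 * j)"] by simp
    also have "\<dots> = 2 * (Suc (2 * j) * (2 * j choose j))"
      by (simp only: Suc_times_binomial)
    finally have "real (Suc j * (Suc (Suc (2 * j)) choose Suc j))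
        = real (2 * (Suc (2 * j) * (2 * j choose j)))"
      by (rule arg_cong)
    then have 2: "(real j + 1) * (2 * Suc j choose Suc j) = (4 * real j + 2) * (2 * j choose j)"
      by (simp add: algebra_simps del: binomial_Suc_Suc)
    have "(real j + 1)\<^sup>2 * ?c (Suc j) = - ((-1) ^ j) *
        ((real j + 1) * (n choose Suc j)) * ((real j + 1) * (2 * Suc j choose Suc j))"
      unfolding coeff_coincidence_poly by (simp add: power2_eq_square)
    also have "\<dots> = - (real n - real j) * (4 * real j + 2) * ?c j"
      unfolding 1 2 coeff_coincidence_poly by algebra
    finally show ?thesis .
  qed
  show "coeff ([:0, 1, -4:] * pderiv (pderiv (coincidence_poly n))
    + [:1, 4 * of_nat n - 6:] * pderiv (coincidence_poly n)
    + smult (2 * of_nat n) (coincidence_poly n)) j = coeff 0 j"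
    \<comment> \<open>Degrees 0, 1 and at least 2 are separated because the factor
      \<open>[:0, 1, -4:]\<close> shifts indices by up to two.\<close>
    using rec
    by (cases j; cases "j - 1") (simp_all add: coeff_pderiv coeff_pCons algebra_simps power2_eq_square)
qed

section \<open>Minimum principle and comparison with powers\<close>

text \<open>At a minimizer of \<open>g\<close> either \<open>g'\<close> or \<open>h\<close>
  vanishes, so \<open>p * g\<close> is nonnegative there; the degeneracy of \<open>h\<close> at the
  end points takes the place of boundary values of \<open>g\<close>.\<close>

lemma minimum_principle:
  fixes g g' h p :: "real \<Rightarrow> real"
  assumes "a \<le> b" and "h a = 0" and "h b = 0"
    and deriv: "\<And>x. x \<in> {a..b} \<Longrightarrow> (g has_real_derivative g' x) (at x)"
    and pos: "\<And>x. x \<in> {a..b} \<Longrightarrow> 0 < p x"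
    and super: "\<And>x. x \<in> {a..b} \<Longrightarrow> 0 \<le> h x * g' x + p x * g x"
    and "x \<in> {a..b}"
  shows "0 \<le> g x"
proof -
  have "continuous_on {a..b} g"
    using deriv by (meson DERIV_isCont continuous_at_imp_continuous_on)
  then obtain m where m: "m \<in> {a..b}" "\<And>y. y \<in> {a..b} \<Longrightarrow> g m \<le> g y"
    using continuous_attains_inf[of "{a..b}" g] \<open>a \<le> b\<close> by auto
  have "h m * g' m = 0"
  proof (cases "m = a \<or> m = b")
    case False
    then have "a < m" "m < b" using m(1) by auto
    have "g' m = 0"
    proof (rule DERIV_local_min)
      show "(g has_real_derivative g' m) (at m)" using deriv m(1) .
      show "0 < min (m - a) (b - m)" using \<open>a < m\<close> \<open>m < b\<close> by simp
      show "\<forall>y. \<bar>m - y\<bar> < min (m - a) (b - m) \<longrightarrow> g m \<le> g y"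
        using m(2) by (auto simp: abs_if split: if_splits)
    qed
    then show ?thesis by simp
  qed (use \<open>h a = 0\<close> \<open>h b = 0\<close> in auto)
  then have "0 \<le> p m * g m" using super[OF m(1)] by linarith
  then have "0 \<le> g m" using pos[OF m(1)] by (simp add: zero_le_mult_iff)
  then show ?thesis using m(2)[OF \<open>x \<in> {a..b}\<close>] by simp
qed

text \<open>Every such \<open>x\<close> is \<open>t * (1 - t)\<close> for a real \<open>t\<close>,
  where the polynomial equals a sum of squares.\<close>

lemma coincidence_poly_nonneg:
  assumes "x \<in> {0..1/4}"
  shows "0 \<le> poly (coincidence_poly n) x"
proof -
  define t where "t = (1 - sqrt (1 - 4 * x)) / 2"
  have "t * (1 - t) = (1 - (sqrt (1 - 4 * x))\<^sup>2) / 4"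
    by (simp add: t_def power2_eq_square field_simps)
  also have "\<dots> = x" using assms by simp
  finally have "poly (coincidence_poly n) x = index_of_coincidence_binomial n t"
    by (simp add: index_of_coincidence_binomial_eq_poly)
  then show ?thesis by (simp add: index_of_coincidence_binomial_def sum_nonneg)
qed

text \<open>The factor \<open>s\<close> is \<open>1\<close> for the lower bound and \<open>-1\<close> for the upper bound.\<close>

lemma coincidence_poly_logderiv_bound:
  fixes c s :: real and n :: nat and F F' :: "real \<Rightarrow> real"
  defines "F \<equiv> poly (coincidence_poly n)" and "F' \<equiv> poly (pderiv (coincidence_poly n))"
  assumes pos: "\<And>x. x \<in> {0..1/4} \<Longrightarrow> 0 < 1 + (2 * real n - 6) * x + ((4 * real n - 2) * c + 8 * real n) * x\<^sup>2"
    and R: "\<And>x. x \<in> {0..1/4} \<Longrightarrow>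
      0 \<le> s * ((2 * real n - 6 - 2 * c) * x + (4 * (c + 2 * real n) + (4 * real n - 6) * c - c\<^sup>2) * x\<^sup>2)"
    and x: "x \<in> {0..1/4}"
  shows "0 \<le> s * (2 * real n * F x + (1 + c * x) * F' x)"
proof (rule minimum_principle[where a = 0 and b = "1/4" and h = "\<lambda>x. x * (1 - 4 * x) * (1 + c * x)"
      and g = "\<lambda>x. s * (2 * real n * F x + (1 + c * x) * F' x)"])
  let ?F'' = "poly (pderiv (pderiv (coincidence_poly n)))"
  let ?G' = "\<lambda>x. s * (2 * real n * F' x + c * F' x + (1 + c * x) * ?F'' x)"
  show "((\<lambda>x. s * (2 * real n * F x + (1 + c * x) * F' x)) has_real_derivative ?G' x) (at x)" for x
    unfolding F_def F'_def
    by (auto intro!: derivative_eq_intros simp: algebra_simps)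
  show "0 < 1 + (2 * real n - 6) * x + ((4 * real n - 2) * c + 8 * real n) * x\<^sup>2" if "x \<in> {0..1/4}" for x
    using pos[OF that] .
  fix x :: real assume x: "x \<in> {0..1/4}"
  have ode: "x * (1 - 4 * x) * ?F'' x = - (1 + (4 * real n - 6) * x) * F' x - 2 * real n * F x"
    using arg_cong[OF coincidence_poly_ode[of n], of "\<lambda>p. poly p x"]
    by (simp add: F_def F'_def algebra_simps)
  have "x * (1 - 4 * x) * (1 + c * x) * ?G' x
      = s * (1 + c * x) * (x * (1 - 4 * x) * (2 * real n + c) * F' x
          + (1 + c * x) * (x * (1 - 4 * x) * ?F'' x))"
    by algebra
  \<comment> \<open>Once \<open>ode\<close> has removed \<open>?F''\<close>, the quadratic
    multiplier is exactly the one that cancels all terms in \<open>F'\<close>. What remains is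
    \<open>2 * real n * s * F x\<close> times the multiplier minus \<open>(1 + c * x)\<close>
    squared.\<close>
  then have "x * (1 - 4 * x) * (1 + c * x) * ?G' x
      + (1 + (2 * real n - 6) * x + ((4 * real n - 2) * c + 8 * real n) * x\<^sup>2)
          * (s * (2 * real n * F x + (1 + c * x) * F' x))
      = 2 * real n * (s * ((2 * real n - 6 - 2 * c) * x
          + (4 * (c + 2 * real n) + (4 * real n - 6) * c - c\<^sup>2) * x\<^sup>2)) * F x"
    unfolding ode by algebra
  also have "0 \<le> \<dots>"
    unfolding F_def
    by (intro mult_nonneg_nonneg[OF mult_nonneg_nonneg[OF _ R[OF x]]] coincidence_poly_nonneg[OF x])
      simp
  finally show "0 \<le> x * (1 - 4 * x) * (1 + c * x) * ?G' x
      + (1 + (2 * real n - 6) * x + ((4 * real n - 2) * c + 8 * real n) * x\<^sup>2)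
          * (s * (2 * real n * F x + (1 + c * x) * F' x))" .
qed (use x in auto)

text \<open>\<open>K\<close> is the reciprocal of the bound. Its equation makes the derivative of
  \<open>s * F * K\<close> a positive multiple of the quantity in \<open>bound\<close>, so this
  product is nondecreasing from its value \<open>s\<close> at 0. Keeping \<open>K\<close> abstract
  covers both powers and the exponential.\<close>

lemma coincidence_poly_compare:
  fixes c s :: real and n :: nat and K K' :: "real \<Rightarrow> real"
  assumes bound: "\<And>x. x \<in> {0..1/4} \<Longrightarrow> 0 \<le> s * (2 * real n * poly (coincidence_poly n) x
        + (1 + c * x) * poly (pderiv (coincidence_poly n)) x)"
    and D: "\<And>x. x \<in> {0..1/4} \<Longrightarrow> 0 < 1 + c * x"
    and K: "\<And>x. x \<in> {0..1/4} \<Longrightarrow> (K has_real_derivative K' x) (at x)"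
    and K': "\<And>x. x \<in> {0..1/4} \<Longrightarrow> (1 + c * x) * K' x = 2 * real n * K x"
    and "\<And>x. x \<in> {0..1/4} \<Longrightarrow> 0 < K x" and "K 0 = 1"
    and x: "x \<in> {0..1/4}"
  shows "s \<le> s * (poly (coincidence_poly n) x * K x)"
proof -
  let ?F = "poly (coincidence_poly n)" and ?F' = "poly (pderiv (coincidence_poly n))"
  have "s * (?F 0 * K 0) \<le> s * (?F x * K x)"
  proof (rule DERIV_nonneg_imp_nondecreasing[where f = "\<lambda>x. s * (?F x * K x)"])
    fix y assume "0 \<le> y" "y \<le> x"
    with x have y: "y \<in> {0..1/4}" by auto
    have "(1 + c * y) * (s * (?F' y * K y + K' y * ?F y))
        = K y * (s * (2 * real n * ?F y + (1 + c * y) * ?F' y))"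
      using K'[OF y] by algebra
    also have "0 \<le> \<dots>" using bound[OF y] assms(5)[OF y] by simp
    finally have "0 \<le> s * (?F' y * K y + K' y * ?F y)"
      using D[OF y] by (simp add: zero_le_mult_iff)
    moreover have "((\<lambda>x. s * (?F x * K x)) has_real_derivative
        s * (?F' y * K y + K' y * ?F y)) (at y)"
      by (intro DERIV_cmult DERIV_mult poly_DERIV K y)
    ultimately show "\<exists>d. ((\<lambda>x. s * (?F x * K x)) has_real_derivative d) (at y) \<and> 0 \<le> d"
      by blast
  qed (use x in auto)
  moreover have "?F 0 = 1"
    by (simp add: poly_0_coeff_0 coeff_coincidence_poly)
  ultimately show ?thesis using \<open>K 0 = 1\<close> by simp
qed

lemma coincidence_poly_compare_powr:
  fixes c s :: real and n :: nat
  assumes bound: "\<And>x. x \<in> {0..1/4} \<Longrightarrow> 0 \<le> s * (2 * real n * poly (coincidence_poly n) x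
        + (1 + c * x) * poly (pderiv (coincidence_poly n)) x)"
    and D: "\<And>x. x \<in> {0..1/4} \<Longrightarrow> 0 < 1 + c * x"
    and "c \<noteq> 0" and x: "x \<in> {0..1/4}"
  shows "s * (1 + c * x) powr (- (2 * real n / c)) \<le> s * poly (coincidence_poly n) x"
proof -
  let ?K = "\<lambda>x. (1 + c * x) powr (2 * real n / c)"
  have "s \<le> s * (poly (coincidence_poly n) x * ?K x)"
  proof (rule coincidence_poly_compare[OF bound D])
    fix y :: real assume y: "y \<in> {0..1/4}"
    note Dy = D[OF y]
    show "(?K has_real_derivative (2 * real n / c * c * (1 + c * y) powr (2 * real n / c - 1))) (at y)"
      using Dy by (auto intro!: derivative_eq_intros)
    show "(1 + c * y) * (2 * real n / c * c * (1 + c * y) powr (2 * real n / c - 1)) = 2 * real n * ?K y"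
      using Dy \<open>c \<noteq> 0\<close> by (simp add: powr_diff)
    show "0 < ?K y" using Dy by simp
  qed (use x in auto)
  then have "s * ?K x powr (-1) \<le> s * (poly (coincidence_poly n) x * ?K x) * ?K x powr (-1)"
    by (rule mult_right_mono) simp
  also have "\<dots> = s * poly (coincidence_poly n) x"
    using D[OF x] by (simp add: powr_minus)
  finally show ?thesis by (simp only: powr_powr mult_minus_right mult_1_right)
qed

section \<open>The two choices of \<open>c\<close>\<close>

text \<open>For \<open>c = n - 3\<close> the linear term of the quadratic R vanishes, leaving
  \<open>3 * (n - 1) * (n + 1) * x^2\<close>; the multiplier p is this plus the square of
  \<open>1 + c * x\<close>.\<close>

lemma coincidence_poly_lower:
  fixes n :: nat
  assumes "n \<ge> 1" and x: "x \<in> {0..1/4}"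
  shows "(if n = 3 then exp (- 6 * x) else (1 + (real n - 3) * x) powr (- (2 * real n / (real n - 3))))
    \<le> poly (coincidence_poly n) x"
proof -
  have n: "real n \<ge> 1" using assms(1) by simp
  have D: "0 < 1 + (real n - 3) * x" if "x \<in> {0..1/4}" for x
  proof -
    have "0 \<le> (real n - 1) * x" using that n by simp
    then show ?thesis using that by (simp add: algebra_simps)
  qed
  have bound: "0 \<le> 1 * (2 * real n * poly (coincidence_poly n) x
        + (1 + (real n - 3) * x) * poly (pderiv (coincidence_poly n)) x)"
    if "x \<in> {0..1/4}" for x
  proof (rule coincidence_poly_logderiv_bound[OF _ _ that])
    fix x :: real assume x: "x \<in> {0..1/4}"
    have "0 < (1 + (real n - 3) * x)\<^sup>2 + 3 * (real n - 1) * (real n + 1) * x\<^sup>2"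
      using D[OF x] n by (intro add_pos_nonneg) auto
    also have "\<dots> = 1 + (2 * real n - 6) * x + ((4 * real n - 2) * (real n - 3) + 8 * real n) * x\<^sup>2"
      by algebra
    finally show "0 < 1 + (2 * real n - 6) * x
        + ((4 * real n - 2) * (real n - 3) + 8 * real n) * x\<^sup>2" .
    have "0 \<le> 3 * (real n - 1) * (real n + 1) * x\<^sup>2"
      using n by simp
    also have "\<dots> = 1 * ((2 * real n - 6 - 2 * (real n - 3)) * x
        + (4 * (real n - 3 + 2 * real n) + (4 * real n - 6) * (real n - 3) - (real n - 3)\<^sup>2) * x\<^sup>2)"
      by algebra
    finally show "0 \<le> 1 * ((2 * real n - 6 - 2 * (real n - 3)) * x
        + (4 * (real n - 3 + 2 * real n) + (4 * real n - 6) * (real n - 3) - (real n - 3)\<^sup>2) * x\<^sup>2)" .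
  qed
  show ?thesis
  proof (cases "n = 3")
    case True
    \<comment> \<open>Here \<open>c = 0\<close>, so the equation for \<open>K\<close> is
      \<open>K' = 6 * K\<close>.\<close>
    have "1 \<le> 1 * (poly (coincidence_poly n) x * exp (6 * x))"
    proof (rule coincidence_poly_compare[OF bound D])
      fix y :: real
      show "((\<lambda>x. exp (6 * x)) has_real_derivative 6 * exp (6 * y)) (at y)"
        by (auto intro!: derivative_eq_intros)
    qed (use True x in auto)
    then show ?thesis using True by (simp add: exp_minus field_simps)
  next
    case False
    then have "real n - 3 \<noteq> 0" by auto
    from coincidence_poly_compare_powr[OF bound D this x] False show ?thesis by simp
  qed
qed

text \<open>For this \<open>c\<close>, R divided by \<open>x\<close> is affine with slope
  \<open>q \<ge> 0\<close>, so its sign only has to be checked at \<open>x = 1/4\<close>.\<close>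

lemma coincidence_poly_upper:
  fixes n :: nat
  assumes "n \<ge> 1" and x: "x \<in> {0..1/4}"
  shows "poly (coincidence_poly n) x
    \<le> (1 + (4 * (real n)\<^sup>2 - 2 * real n - 4) / (real n + 1) * x) powr
               (- (real n * (real n + 1) / (2 * (real n)\<^sup>2 - real n - 2)))"
proof -
  define c where "c = (4 * (real n)\<^sup>2 - 2 * real n - 4) / (real n + 1)"
  have n: "real n \<ge> 1" using assms(1) by simp
  have c: "c = 4 * real n - 6 + 2 / (real n + 1)"
    unfolding c_def using n by (simp add: field_simps power2_eq_square)
  have c_mult: "c * (real n + 1) = 4 * (real n)\<^sup>2 - 2 * real n - 4"
    by (simp add: c_def)
  have c_gt: "c > 4 * real n - 6" unfolding c by simp
  \<comment> \<open>The bound -1 is attained at \<open>n = 1\<close>.\<close>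
  have "0 \<le> (real n - 1) * (4 * real n + 3)" using n by simp
  also have "\<dots> = (c + 1) * (real n + 1)" using c_mult by algebra
  finally have c_ge: "c \<ge> -1" by (simp add: zero_le_mult_iff)
  have D: "0 < 1 + c * x" if "x \<in> {0..1/4}" for x
  proof -
    have "0 \<le> (c + 1) * x" using that c_ge by simp
    then show ?thesis using that by (simp add: algebra_simps)
  qed
  have c0: "c \<noteq> 0"
  proof (cases "n = 1")
    case False
    then have "real n \<ge> 2" using assms(1) by simp
    then show ?thesis using c_gt by simp
  qed (simp add: c_def)
  have bound: "0 \<le> (-1) * (2 * real n * poly (coincidence_poly n) x
        + (1 + c * x) * poly (pderiv (coincidence_poly n)) x)"
    if "x \<in> {0..1/4}" for x
  proof (rule coincidence_poly_logderiv_bound[OF _ _ that])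
    fix x :: real assume x: "x \<in> {0..1/4}"
    show "0 < 1 + (2 * real n - 6) * x + ((4 * real n - 2) * c + 8 * real n) * x\<^sup>2"
    proof (cases "x = 0")
      case False
      \<comment> \<open>Completing the square: the multiplier is \<open>(1 + (n - 3) * x)^2\<close>
        plus a multiple of \<open>x^2\<close>, whose coefficient is shown to be positive.\<close>
      have "0 \<le> 3 * (5 * real n - 1) * (real n - 1)" using n by simp
      then have "(real n - 3)\<^sup>2 \<le> (4 * real n - 2) * (4 * real n - 6) + 8 * real n"
        by (simp add: power2_eq_square algebra_simps)
      also have "\<dots> < (4 * real n - 2) * c + 8 * real n"
        using c_gt n by (intro add_strict_right_mono mult_strict_left_mono) auto
      finally have "(real n - 3)\<^sup>2 * x\<^sup>2 < ((4 * real n - 2) * c + 8 * real n) * x\<^sup>2"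
        using False by (intro mult_strict_right_mono) auto
      moreover have "0 \<le> (1 + (real n - 3) * x)\<^sup>2" by simp
      ultimately show ?thesis by (simp add: power2_eq_square algebra_simps)
    qed simp
    define q where "q = 4 * (c + 2 * real n) + (4 * real n - 6) * c - c\<^sup>2"
    have "0 \<le> (4 * real n + 2) * (c + 1) + (8 * (real n)\<^sup>2 + (4 * real n - 2))"
      using mult_nonneg_nonneg[of "4 * real n + 2" "c + 1"] c_ge n
      by (intro add_nonneg_nonneg) simp_all
    also have "\<dots> = q * (real n + 1)"
      unfolding q_def using c_mult by algebra
    finally have "0 \<le> q" by (simp add: zero_le_mult_iff)
    \<comment> \<open>This is 16 times R at 1/4, up to the factor \<open>n + 1\<close>. It factors
      as \<open>(4 * n - 6 - c) * (c + 4)\<close>, and \<open>c\<close> exceeds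
      \<open>4 * n - 6\<close> by \<open>2 / (n + 1)\<close>.\<close>
    have "(4 * (2 * real n - 6 - 2 * c) + q) * (real n + 1) = - (8 + 2 * c)"
      unfolding q_def using c_mult by algebra
    then have "(4 * (2 * real n - 6 - 2 * c) + q) * (real n + 1) \<le> 0" using c_ge by simp
    then have "4 * (2 * real n - 6 - 2 * c) + q \<le> 0"
      by (simp add: mult_le_0_iff)
    moreover have "q * (4 * x) \<le> q * 1"
      using \<open>0 \<le> q\<close> x by (intro mult_left_mono) auto
    ultimately have "0 \<le> x * - ((2 * real n - 6 - 2 * c) + q * x)"
      using x by (intro mult_nonneg_nonneg) auto
    then show "0 \<le> (-1) * ((2 * real n - 6 - 2 * c) * x
        + (4 * (c + 2 * real n) + (4 * real n - 6) * c - c\<^sup>2) * x\<^sup>2)"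
      unfolding q_def[symmetric] by (simp add: power2_eq_square algebra_simps)
  qed
  have "real n * (real n + 1) / (2 * (real n)\<^sup>2 - real n - 2) = 2 * real n / c"
  proof -
    have "2 * (2 * (real n)\<^sup>2 - real n - 2) = c * (real n + 1)" using c_mult by simp
    then have e: "2 * (real n)\<^sup>2 - real n - 2 = c * (real n + 1) / 2" by simp
    show ?thesis unfolding e by (subst frac_eq_eq) (use c0 n in auto)
  qed
  with coincidence_poly_compare_powr[OF bound D c0 x] show ?thesis by (simp add: c_def)
qed

theorem mainTheorem5:
  fixes n :: nat and t T :: real
  assumes "n \<ge> 1"
    and "t \<in> {0..1}"
    and "T = t * (1 - t)"
  shows "(if n = 3 then exp (- 6 * T)
          else (1 + (real n - 3) * T) powr (- (2 * real n / (real n - 3))))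
           \<le> index_of_coincidence_binomial n t
       \<and> index_of_coincidence_binomial n t
           \<le> (1 + (4 * (real n)\<^sup>2 - 2 * real n - 4) / (real n + 1) * T) powr
               (- (real n * (real n + 1) / (2 * (real n)\<^sup>2 - real n - 2)))"
proof -
  have "0 \<le> T" using assms(2,3) by simp
  moreover have "T \<le> 1/4"
    using assms(3) zero_le_power2[of "t - 1/2"] by (simp add: power2_eq_square algebra_simps)
  ultimately have "T \<in> {0..1/4}" by simp
  then show ?thesis
    using coincidence_poly_lower[OF assms(1), of T] coincidence_poly_upper[OF assms(1), of T]
    unfolding index_of_coincidence_binomial_eq_poly assms(3) by blast
qed

end
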